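(* Suppose $\mu$ is a finite Borel measure on $\mathbb{R}^d$ and there exist $0\leq\alpha<\beta\leq d$ such that (i) there are a nonzero $f\in L^2(\mu)$ and a constant $C$ with $|\widehat{f\,d\mu}(\xi)|\leq C|\xi|^{-\beta/2}$ for all $\xi\neq 0$; and (ii) there is a constant $c>0$ with $\sup_{x}\mu(B(x,r))\geq c\,r^{\alpha}$ for all $0<r\leq 1$. Then $\mu$ admits no Fourier frame.
   Context: For $f\in L^2(\mu)$, $\widehat{f\,d\mu}(\xi)=\int e^{-2\pi i x\cdot\xi}f(x)\,d\mu(x)$; $B(x,r)$ is the ball of radius $r$ centered at $x$. A discrete set $\Lambda\subset\mathbb{R}^d$ is a frame spectrum of $\mu$ if there exist constants $0<A\leq B<\infty$ with $$A\|f\|_{L^2(\mu)}^2\leq\sum_{\lambda\in\Lambda}|\widehat{f\,d\mu}(\lambda)|^2\leq B\|f\|_{L^2(\mu)}^2\quad\forall f\in L^2(\mu).$$ If such a $\Lambda$ exists, $\mu$ is said to admit a Fourier frame. *)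

theory Defs
  imports "HOL-Analysis.Analysis"
begin

definition finite_borel_measure :: "'a::topological_space measure \<Rightarrow> bool" where
  "finite_borel_measure \<mu> \<longleftrightarrow> sets \<mu> = sets borel \<and> finite_measure \<mu>"

text \<open>Complex-valued \<open>L\<^sup>2\<close> functions, as functions rather than classes modulo
  almost-everywhere equality; \<open>f\<close> is the zero element iff it vanishes almost everywhere.\<close>

definition L2 :: "'a measure \<Rightarrow> ('a \<Rightarrow> complex) set" where
  "L2 \<mu> = {f \<in> borel_measurable \<mu>. integrable \<mu> (\<lambda>x. (cmod (f x))\<^sup>2)}"

definition L2_norm :: "'a measure \<Rightarrow> ('a \<Rightarrow> complex) \<Rightarrow> real" where
  "L2_norm \<mu> f = sqrt (\<integral>x. (cmod (f x))\<^sup>2 \<partial>\<mu>)"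

definition fourier :: "'a::euclidean_space measure \<Rightarrow> ('a \<Rightarrow> complex) \<Rightarrow> 'a \<Rightarrow> complex" where
  "fourier \<mu> f \<xi> = (\<integral>x. exp (- 2 * of_real pi * \<i> * of_real (x \<bullet> \<xi>)) * f x \<partial>\<mu>)"

text \<open>Summability is part of the upper bound and has to be demanded explicitly, since
  \<open>infsum\<close> is \<open>0\<close> for families that are not summable.\<close>

definition frame_spectrum :: "'a::euclidean_space measure \<Rightarrow> 'a set \<Rightarrow> bool" where
  "frame_spectrum \<mu> \<Lambda> \<longleftrightarrow> discrete \<Lambda> \<and>
     (\<exists>A B. 0 < A \<and> A \<le> B \<and>
       (\<forall>f\<in>L2 \<mu>.
          (\<lambda>\<xi>. (cmod (fourier \<mu> f \<xi>))\<^sup>2) summable_on \<Lambda> \<and>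
          A * (L2_norm \<mu> f)\<^sup>2 \<le> (\<Sum>\<^sub>\<infinity>\<xi>\<in>\<Lambda>. (cmod (fourier \<mu> f \<xi>))\<^sup>2) \<and>
          (\<Sum>\<^sub>\<infinity>\<xi>\<in>\<Lambda>. (cmod (fourier \<mu> f \<xi>))\<^sup>2) \<le> B * (L2_norm \<mu> f)\<^sup>2))"

definition admits_fourier_frame :: "'a::euclidean_space measure \<Rightarrow> bool" where
  "admits_fourier_frame \<mu> \<longleftrightarrow> (\<exists>\<Lambda>. frame_spectrum \<mu> \<Lambda>)"

end

theory Submission
  imports Defs
begin

text \<open>Suppose \<open>\<Lambda>\<close> is a frame spectrum. Testing the upper frame bound on modulated indicators of
  balls of radius about \<open>1/R\<close> and mass at least about \<open>R\<^sup>-\<^sup>\<alpha>\<close> shows that every ball of radius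
  \<open>R \<ge> 1\<close> contains \<open>O(R\<^sup>\<alpha>)\<close> points of \<open>\<Lambda>\<close>. As \<open>\<alpha> < d\<close>, comparing volumes yields arbitrarily
  large balls free of points of \<open>\<Lambda>\<close>. If \<open>\<Lambda>\<close> misses the ball of radius \<open>R\<close> about \<open>\<eta>\<close>, the
  lower frame bound for the modulation of \<open>f\<close> by \<open>\<eta>\<close>, together with the decay of its transform
  and a dyadic decomposition, bounds the squared norm of \<open>f\<close> by \<open>O(R\<^sup>\<alpha>\<^sup>-\<^sup>\<beta>)\<close>, hence \<open>f = 0\<close>.\<close>

section \<open>Modulations, indicators and their norms\<close>

definition modulate :: "'a::euclidean_space \<Rightarrow> ('a \<Rightarrow> complex) \<Rightarrow> 'a \<Rightarrow> complex" where
  "modulate \<eta> f x = exp (2 * of_real pi * \<i> * of_real (x \<bullet> \<eta>)) * f x"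

lemma norm_exp_2pi_i [simp]:
  "cmod (exp (2 * of_real pi * \<i> * of_real t)) = 1"
  "cmod (exp (- (2 * of_real pi * \<i> * of_real t))) = 1"
  by (simp_all add: norm_exp_eq_Re)

lemma norm_modulate [simp]: "cmod (modulate \<eta> f x) = cmod (f x)"
  by (simp add: modulate_def norm_mult)

text \<open>Modulation translates the transform and leaves the norm alone, so the frame bounds can
  be tested with a transform recentred at any point \<open>\<eta>\<close>.\<close>

lemma fourier_modulate: "fourier \<mu> (modulate \<eta> f) \<xi> = fourier \<mu> f (\<xi> - \<eta>)"
  unfolding fourier_def modulate_def mult.assoc[symmetric] exp_add[symmetric]
  by (simp add: inner_diff_right algebra_simps)

lemma modulate_in_L2:
  assumes "sets \<mu> = sets borel" and "f \<in> L2 \<mu>"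
  shows "modulate \<eta> f \<in> L2 \<mu>"
proof -
  have [measurable]: "f \<in> borel_measurable \<mu>"
    using assms(2) by (simp add: L2_def)
  have [measurable_cong]: "sets \<mu> = sets borel" by fact
  have "modulate \<eta> f \<in> borel_measurable \<mu>"
    unfolding modulate_def by measurable
  then show ?thesis
    using assms(2) by (simp add: L2_def)
qed

lemma L2_norm_modulate [simp]: "L2_norm \<mu> (modulate \<eta> f) = L2_norm \<mu> f"
  by (simp add: L2_norm_def)

lemma L2_norm_power2: "(L2_norm \<mu> f)\<^sup>2 = (\<integral>x. (cmod (f x))\<^sup>2 \<partial>\<mu>)"
  by (simp add: L2_norm_def)

lemma L2_norm_eq_0_iff:
  assumes "f \<in> L2 \<mu>"
  shows "L2_norm \<mu> f = 0 \<longleftrightarrow> (AE x in \<mu>. f x = 0)"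
  using assms by (simp add: L2_norm_def L2_def integral_nonneg_eq_0_iff_AE)

lemma indicator_in_L2:
  assumes "finite_measure \<mu>" and "S \<in> sets \<mu>"
  shows "(indicator S :: _ \<Rightarrow> complex) \<in> L2 \<mu>"
    and "(L2_norm \<mu> (indicator S))\<^sup>2 = measure \<mu> S"
proof -
  interpret finite_measure \<mu> by fact
  have eq: "(\<lambda>x. (cmod (indicator S x))\<^sup>2) = (indicator S :: _ \<Rightarrow> real)"
    by (auto simp: indicator_def fun_eq_iff)
  show "(indicator S :: _ \<Rightarrow> complex) \<in> L2 \<mu>"
    using assms(2) by (simp add: L2_def eq emeasure_eq_measure less_top[symmetric])
  show "(L2_norm \<mu> (indicator S))\<^sup>2 = measure \<mu> S"
    using assms(2) sets.sets_into_space[OF assms(2)]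
    by (simp add: L2_norm_power2 eq Int_absorb2)
qed

section \<open>Counting points with the upper frame bound\<close>

lemma norm_exp_2pi_i_diff_le:
  "cmod (exp (- 2 * of_real pi * \<i> * of_real s) - exp (- 2 * of_real pi * \<i> * of_real t))
     \<le> 2 * pi * \<bar>s - t\<bar>"
proof -
  have "exp (- 2 * of_real pi * \<i> * of_real s) - exp (- 2 * of_real pi * \<i> * of_real t) =
      exp (- (2 * of_real pi * \<i> * of_real t)) * (exp (\<i> * of_real (2 * pi * (t - s))) - 1)"
    by (simp add: algebra_simps exp_add[symmetric])
  then have "cmod (exp (- 2 * of_real pi * \<i> * of_real s) - exp (- 2 * of_real pi * \<i> * of_real t))
      = 2 * \<bar>sin (2 * pi * (t - s) / 2)\<bar>"
    by (simp only: norm_mult norm_exp_2pi_i dist_exp_i_1)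
  also have "\<dots> \<le> 2 * \<bar>2 * pi * (t - s) / 2\<bar>"
    by (intro mult_left_mono abs_sin_x_le_abs_x) simp
  also have "\<dots> = 2 * pi * \<bar>s - t\<bar>"
    by (simp add: abs_mult)
  finally show ?thesis .
qed

text \<open>On the ball the phase stays within 1/16 of its value at the centre, so the exponential
  differs from a constant of modulus 1 by at most 1/2. Cancellation therefore destroys at most half
  of the mass.\<close>

lemma half_measure_le_fourier_indicator_ball:
  fixes \<mu> :: "'a::euclidean_space measure"
  assumes "sets \<mu> = sets borel" and "finite_measure \<mu>" and "r * norm \<xi> \<le> 1 / 16"
  shows "measure \<mu> (ball x r) / 2 \<le> cmod (fourier \<mu> (indicator (ball x r)) \<xi>)"
proof -
  interpret finite_measure \<mu> by fact
  have [measurable_cong]: "sets \<mu> = sets borel" by fact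
  define S where "S = ball x r"
  have [measurable]: "S \<in> sets \<mu>" by (simp add: S_def assms(1))
  define e where "e y = exp (- 2 * complex_of_real pi * \<i> * of_real (y \<bullet> \<xi>))" for y
  have [measurable]: "e \<in> borel_measurable \<mu>" unfolding e_def by measurable
  have norm_e: "cmod (e y) = 1" for y by (simp add: e_def)
  have int: "integrable \<mu> (\<lambda>y. e y * indicator S y)"
    by (rule integrable_const_bound[of _ 1]) (auto simp: norm_mult norm_e indicator_def)
  have int_c: "integrable \<mu> (\<lambda>y. e x * indicator S y)"
    by (rule integrable_const_bound[of _ 1]) (auto simp: norm_mult norm_e indicator_def)
  have int_half: "integrable \<mu> (\<lambda>y. 1 / 2 * indicator S y :: real)"
    by (rule integrable_const_bound[of _ 1]) (auto simp: indicator_def)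
  have integral_indicator: "(\<integral>y. indicator S y \<partial>\<mu>) = complex_of_real (measure \<mu> S)"
    using sets.sets_into_space[OF \<open>S \<in> sets \<mu>\<close>]
      integral_complex_of_real[of \<mu> "indicator S"] by (simp add: of_real_indicator Int_absorb2)
  have near: "cmod (e y - e x) \<le> 1 / 2" if "y \<in> S" for y
  proof -
    have "cmod (e y - e x) \<le> 2 * pi * \<bar>(y - x) \<bullet> \<xi>\<bar>"
      unfolding e_def inner_diff_left by (rule norm_exp_2pi_i_diff_le)
    also have "\<dots> \<le> 2 * pi * (norm (y - x) * norm \<xi>)"
      by (intro mult_left_mono Cauchy_Schwarz_ineq2) simp
    also have "norm (y - x) * norm \<xi> \<le> r * norm \<xi>"
      using that by (intro mult_right_mono) (auto simp: S_def dist_norm norm_minus_commute)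
    also have "r * norm \<xi> \<le> 1 / 16" by fact
    also have "2 * pi * (1 / 16) \<le> 1 / 2" using pi_less_4 by simp
    finally show ?thesis by simp
  qed
  have "cmod (fourier \<mu> (indicator S) \<xi> - e x * measure \<mu> S)
      = cmod (\<integral>y. e y * indicator S y - e x * indicator S y \<partial>\<mu>)"
    by (subst Bochner_Integration.integral_diff[OF int int_c])
       (simp add: fourier_def e_def integral_indicator)
  also have "\<dots> \<le> (\<integral>y. 1 / 2 * indicator S y \<partial>\<mu>)"
    using near by (intro Bochner_Integration.integral_norm_bound_integral
        Bochner_Integration.integrable_diff int int_c int_half) (auto simp: indicator_def)
  also have "\<dots> = measure \<mu> S / 2"
    using sets.sets_into_space[OF \<open>S \<in> sets \<mu>\<close>] by (simp add: Int_absorb2)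
  finally have "cmod (e x * measure \<mu> S - fourier \<mu> (indicator S) \<xi>) \<le> measure \<mu> S / 2"
    by (simp add: norm_minus_commute)
  moreover have "cmod (e x * measure \<mu> S) = measure \<mu> S"
    by (simp add: norm_mult norm_e)
  ultimately show ?thesis
    using norm_triangle_ineq2[of "e x * measure \<mu> S" "fourier \<mu> (indicator S) \<xi>"]
    unfolding S_def by linarith
qed

text \<open>The Bessel inequality is tested on the indicator of the small ball, modulated by
  \<open>\<eta>\<close>. If m is the mass of that ball, each point of \<open>F\<close> contributes
  at least (m/2)^2, whereas the right-hand side is only B m.\<close>

lemma bessel_card_le:
  fixes \<mu> :: "'a::euclidean_space measure"
  assumes \<mu>: "sets \<mu> = sets borel" "finite_measure \<mu>"
    and bessel: "\<And>f F. f \<in> L2 \<mu> \<Longrightarrow> finite F \<Longrightarrow> F \<subseteq> \<Lambda> \<Longrightarrow>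
      (\<Sum>\<xi>\<in>F. (cmod (fourier \<mu> f \<xi>))\<^sup>2) \<le> B * (L2_norm \<mu> f)\<^sup>2"
    and F: "finite F" "F \<subseteq> \<Lambda> \<inter> ball \<eta> R"
    and r: "0 \<le> r" "r * R \<le> 1 / 16"
    and pos: "measure \<mu> (ball x r) > 0"
  shows "card F \<le> 4 * B / measure \<mu> (ball x r)"
proof -
  let ?m = "measure \<mu> (ball x r)"
  let ?f = "indicator (ball x r) :: 'a \<Rightarrow> complex"
  have meas: "ball x r \<in> sets \<mu>" by (simp add: \<mu>(1))
  have "card F * (?m / 2)\<^sup>2 \<le> (\<Sum>\<xi>\<in>F. (cmod (fourier \<mu> (modulate \<eta> ?f) \<xi>))\<^sup>2)"
  proof (rule sum_bounded_below)
    fix \<xi> assume "\<xi> \<in> F"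
    then have "norm (\<xi> - \<eta>) \<le> R"
      using F(2) by (force simp: dist_norm norm_minus_commute)
    then have "r * norm (\<xi> - \<eta>) \<le> 1 / 16"
      using mult_left_mono[OF _ r(1)] r(2) by force
    from half_measure_le_fourier_indicator_ball[OF \<mu> this]
    show "(?m / 2)\<^sup>2 \<le> (cmod (fourier \<mu> (modulate \<eta> ?f) \<xi>))\<^sup>2"
      by (intro power_mono) (simp_all add: fourier_modulate)
  qed
  also have "\<dots> \<le> B * (L2_norm \<mu> (modulate \<eta> ?f))\<^sup>2"
    using F by (intro bessel modulate_in_L2 \<mu>(1) indicator_in_L2 \<mu>(2) meas) auto
  also have "\<dots> = B * ?m"
    by (simp add: indicator_in_L2(2)[OF \<mu>(2) meas])
  finally have "card F * ?m * ?m \<le> 4 * B * ?m"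
    by (simp add: power2_eq_square)
  then show ?thesis
    using pos by (simp add: field_simps)
qed

text \<open>The test ball gets the largest radius that \<open>bessel_card_le\<close> permits.
  Uniformity in \<open>\<eta>\<close> matters: the count serves at the origin to find a gap in
  \<open>\<Lambda>\<close>, then at the centre of that gap. It speaks of finite \<open>F\<close>
  because \<open>card\<close> is 0 on infinite sets.\<close>

lemma bessel_card_le_powr:
  fixes \<mu> :: "'a::euclidean_space measure"
  assumes \<mu>: "sets \<mu> = sets borel" "finite_measure \<mu>"
    and bessel: "\<And>f F. f \<in> L2 \<mu> \<Longrightarrow> finite F \<Longrightarrow> F \<subseteq> \<Lambda> \<Longrightarrow>
      (\<Sum>\<xi>\<in>F. (cmod (fourier \<mu> f \<xi>))\<^sup>2) \<le> B * (L2_norm \<mu> f)\<^sup>2"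
    and "0 \<le> B" and "0 < c"
    and mass: "\<And>r. 0 < r \<Longrightarrow> r \<le> 1 \<Longrightarrow> c * r powr \<alpha> \<le> (SUP x. measure \<mu> (ball x r))"
  shows "\<exists>K\<ge>0. \<forall>\<eta> R F. 1 \<le> R \<longrightarrow> finite F \<longrightarrow> F \<subseteq> \<Lambda> \<inter> ball \<eta> R \<longrightarrow> card F \<le> K * R powr \<alpha>"
proof (intro exI conjI allI impI)
  \<comment> \<open>The 8 is the 4 of \<open>bessel_card_le\<close> times 2 for settling for half of
    the supremum; \<open>16 powr \<alpha>\<close> comes from the radius 1/(16 R).\<close>
  show "0 \<le> 8 * B / c * 16 powr \<alpha>" using assms(4,5) by simp
next
  fix \<eta> :: 'a and R F assume R: "1 \<le> R" and F: "finite F" "F \<subseteq> \<Lambda> \<inter> ball \<eta> R"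
  interpret finite_measure \<mu> by fact
  define r where "r = 1 / (16 * R)"
  have r: "0 < r" "r \<le> 1" "r * R \<le> 1 / 16"
    using R by (simp_all add: r_def divide_simps)
  \<comment> \<open>The supremum need not be attained; halving makes the inequality strict, which
    yields an actual centre \<open>x\<close>.\<close>
  have "c / 2 * r powr \<alpha> < c * r powr \<alpha>"
    using r \<open>0 < c\<close> by simp
  also have "\<dots> \<le> (SUP x. measure \<mu> (ball x r))"
    using r by (intro mass)
  finally obtain x where x: "c / 2 * r powr \<alpha> < measure \<mu> (ball x r)"
    by (subst (asm) less_cSUP_iff) (auto intro!: bdd_aboveI2 bounded_measure)
  have lb: "0 < c / 2 * r powr \<alpha>" using r \<open>0 < c\<close> by simp
  have "card F \<le> 4 * B / measure \<mu> (ball x r)"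
    using r x lb by (intro bessel_card_le[OF \<mu> bessel F]) auto
  also have "\<dots> \<le> 4 * B / (c / 2 * r powr \<alpha>)"
    using x lb \<open>0 \<le> B\<close> \<open>0 < c\<close> by (intro divide_left_mono mult_pos_pos) auto
  also have "\<dots> = 8 * B / c * 16 powr \<alpha> * R powr \<alpha>"
    using R by (simp add: r_def powr_divide powr_mult)
  finally show "card F \<le> 8 * B / c * 16 powr \<alpha> * R powr \<alpha>" .
qed

section \<open>Large balls free of points\<close>

text \<open>If every ball of radius \<open>R\<close> met \<open>\<Lambda>\<close>, the balls of
  radius \<open>R\<close> about points of \<open>\<Lambda>\<close> would cover a ball of radius
  \<open>M\<close>. Its volume grows like M^d, but the cover consists of only O(M^\<alpha>) balls of
  fixed volume, which is impossible for large \<open>M\<close>.\<close>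

lemma exists_ball_disjoint:
  fixes \<Lambda> :: "'a::euclidean_space set" and \<alpha> :: real
  assumes "\<alpha> < DIM('a)" and "0 < R"
    and card: "\<And>M F. 1 \<le> M \<Longrightarrow> finite F \<Longrightarrow> F \<subseteq> \<Lambda> \<inter> ball 0 M \<Longrightarrow> card F \<le> K * M powr \<alpha>"
  shows "\<exists>\<eta>. \<Lambda> \<inter> ball \<eta> R = {}"
proof (rule ccontr)
  assume "\<not> ?thesis"
  then have hit: "\<And>\<eta>. \<exists>\<xi>\<in>\<Lambda>. dist \<eta> \<xi> < R" by (auto simp: disjoint_iff)
  let ?d = "DIM('a)"
  let ?v = "unit_ball_vol (real ?d)"
  have bound: "1 \<le> K * 2 powr \<alpha> * R ^ ?d * M powr (\<alpha> - ?d)" if M: "1 \<le> M" "R \<le> M" for M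
  proof -
    \<comment> \<open>A point of \<open>ball 0 M\<close> has a point of \<open>\<Lambda>\<close>
      within distance \<open>R \<le> M\<close>, hence the radius \<open>2 * M\<close>.\<close>
    define F where "F = \<Lambda> \<inter> ball 0 (2 * M)"
    \<comment> \<open>Finiteness is not given: it follows from the uniform bound on the size of
      finite subsets.\<close>
    have "finite F"
    proof (rule finite_if_finite_subsets_card_bdd[THEN conjunct1, of _ "nat \<lceil>K * (2 * M) powr \<alpha>\<rceil>"])
      show "card G \<le> nat \<lceil>K * (2 * M) powr \<alpha>\<rceil>" if "G \<subseteq> F" "finite G" for G
        using card[of "2 * M" G] that M by (simp add: F_def) linarith
    qed
    have "ball 0 M \<subseteq> (\<Union>\<xi>\<in>F. ball \<xi> R)"
    proof
      fix \<eta> :: 'a assume "\<eta> \<in> ball 0 M"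
      moreover obtain \<xi> where "\<xi> \<in> \<Lambda>" "dist \<eta> \<xi> < R" using hit by blast
      ultimately show "\<eta> \<in> (\<Union>\<xi>\<in>F. ball \<xi> R)"
        using M(2) dist_triangle[of 0 \<xi> \<eta>] by (auto simp: F_def dist_commute intro!: bexI[of _ \<xi>])
    qed
    then have "measure lborel (ball (0::'a) M) \<le> measure lborel (\<Union>\<xi>\<in>F. ball \<xi> R)"
      using \<open>finite F\<close> by (intro measure_mono_fmeasurable fmeasurable.finite_UN fmeasurableI)
        (auto simp: emeasure_lborel_ball_finite[unfolded infinity_ennreal_def])
    also have "\<dots> \<le> (\<Sum>\<xi>\<in>F. measure lborel (ball \<xi> R))"
      using \<open>finite F\<close> by (intro measure_UNION_le) auto
    also have "\<dots> = card F * (?v * R ^ ?d)"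
      using \<open>0 < R\<close> by (simp add: content_ball)
    also have "\<dots> \<le> K * (2 * M) powr \<alpha> * (?v * R ^ ?d)"
      using card[of "2 * M" F] \<open>finite F\<close> M \<open>0 < R\<close> by (intro mult_right_mono) (auto simp: F_def)
    finally have "?v * M ^ ?d \<le> ?v * (K * (2 * M) powr \<alpha> * R ^ ?d)"
      using M by (simp add: content_ball algebra_simps)
    then have "M ^ ?d \<le> K * (2 * M) powr \<alpha> * R ^ ?d"
      using unit_ball_vol_pos[of "real ?d"] by simp
    then have "M powr real ?d \<le> K * 2 powr \<alpha> * R ^ ?d * M powr \<alpha>"
      using M by (simp add: powr_realpow powr_mult algebra_simps)
    then show ?thesis
      using M by (simp add: powr_diff le_divide_eq)
  qed
  \<comment> \<open>The exponent is negative, so letting \<open>M\<close> tend to infinity in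
    \<open>bound\<close> gives 1 \<le> 0.\<close>
  have "((\<lambda>M. K * 2 powr \<alpha> * R ^ ?d * M powr (\<alpha> - ?d)) \<longlongrightarrow> K * 2 powr \<alpha> * R ^ ?d * 0) at_top"
    using assms(1) by (intro tendsto_mult_left tendsto_neg_powr filterlim_ident) simp
  then have "1 \<le> K * 2 powr \<alpha> * R ^ ?d * 0"
    by (rule tendsto_lowerbound[OF _ eventually_mono[OF eventually_ge_at_top[of "max 1 R"] bound]])
       simp_all
  then show False by simp
qed

section \<open>Dyadic estimate of the tail\<close>

text \<open>The shell between radii 2^k R and 2^(k+1) R holds at most K (2^(k+1) R)^\<alpha> points
  of \<open>F\<close>, each contributing at most (2^k R)^(-\<beta>). The product is the k-th term on
  the right; the induction peels off the outermost shell.\<close>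

lemma sum_powr_dyadic_le:
  fixes \<eta> :: "'a::euclidean_space"
  assumes "0 \<le> K" and "0 \<le> \<beta>" and "1 \<le> R"
    and card: "\<And>R F. 1 \<le> R \<Longrightarrow> finite F \<Longrightarrow> F \<subseteq> \<Lambda> \<inter> ball \<eta> R \<Longrightarrow> card F \<le> K * R powr \<alpha>"
    and F: "finite F" "F \<subseteq> \<Lambda> \<inter> ball \<eta> (2 ^ N * R) - ball \<eta> R"
  shows "(\<Sum>\<xi>\<in>F. norm (\<xi> - \<eta>) powr - \<beta>)
    \<le> K * 2 powr \<alpha> * R powr (\<alpha> - \<beta>) * (\<Sum>k<N. (2 powr (\<alpha> - \<beta>)) ^ k)"
  using F
proof (induction N arbitrary: F)
  case 0
  then have "F = {}" by auto
  then show ?case by simp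
next
  case (Suc N)
  \<comment> \<open>\<open>G\<close> lies in the first \<open>N\<close> shells and is left to the
    induction hypothesis; \<open>F - G\<close> is the shell between \<open>T\<close> and
    \<open>2 * T\<close>.\<close>
  define G where "G = F \<inter> ball \<eta> (2 ^ N * R)"
  define T where "T = 2 ^ N * R"
  have T: "1 \<le> T" "0 < T"
    using \<open>1 \<le> R\<close> mult_mono[of 1 "2 ^ N" 1 R] by (auto simp: T_def)
  have "(\<Sum>\<xi>\<in>F - G. norm (\<xi> - \<eta>) powr - \<beta>) \<le> card (F - G) * T powr - \<beta>"
  proof (rule sum_bounded_above)
    fix \<xi> assume "\<xi> \<in> F - G"
    then have "T \<le> norm (\<xi> - \<eta>)"
      by (auto simp: G_def T_def dist_norm norm_minus_commute)
    then show "norm (\<xi> - \<eta>) powr - \<beta> \<le> T powr - \<beta>"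
      using T \<open>0 \<le> \<beta>\<close> by (intro powr_mono2') auto
  qed
  also have "\<dots> \<le> K * (2 * T) powr \<alpha> * T powr - \<beta>"
    using Suc.prems T by (intro mult_right_mono card) (auto simp: T_def mult.assoc)
  also have "\<dots> = K * 2 powr \<alpha> * T powr (\<alpha> - \<beta>)"
    using T by (simp add: powr_mult powr_diff powr_minus field_simps)
  also have "T powr (\<alpha> - \<beta>) = R powr (\<alpha> - \<beta>) * (2 powr (\<alpha> - \<beta>)) ^ N"
    using \<open>1 \<le> R\<close> by (simp add: T_def powr_mult powr_powr mult.commute flip: powr_realpow)
  finally have outer: "(\<Sum>\<xi>\<in>F - G. norm (\<xi> - \<eta>) powr - \<beta>)
    \<le> K * 2 powr \<alpha> * R powr (\<alpha> - \<beta>) * (2 powr (\<alpha> - \<beta>)) ^ N" by (simp add: mult.assoc)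
  have inner: "(\<Sum>\<xi>\<in>G. norm (\<xi> - \<eta>) powr - \<beta>)
    \<le> K * 2 powr \<alpha> * R powr (\<alpha> - \<beta>) * (\<Sum>k<N. (2 powr (\<alpha> - \<beta>)) ^ k)"
    using Suc.prems by (intro Suc.IH) (auto simp: G_def)
  have "(\<Sum>\<xi>\<in>F. norm (\<xi> - \<eta>) powr - \<beta>)
    = (\<Sum>\<xi>\<in>F - G. norm (\<xi> - \<eta>) powr - \<beta>) + (\<Sum>\<xi>\<in>G. norm (\<xi> - \<eta>) powr - \<beta>)"
    using Suc.prems(1) by (intro sum.subset_diff) (auto simp: G_def)
  then show ?case
    using outer inner by (simp add: algebra_simps)
qed

text \<open>Since \<open>\<alpha> < \<beta>\<close>, the shell contributions are dominated by a
  convergent geometric series, which makes the bound independent of how far out \<open>F\<close>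
  reaches.\<close>

lemma sum_powr_tail_le:
  fixes \<eta> :: "'a::euclidean_space"
  assumes "0 \<le> K" and "0 \<le> \<beta>" and "\<alpha> < \<beta>" and "1 \<le> R"
    and card: "\<And>R F. 1 \<le> R \<Longrightarrow> finite F \<Longrightarrow> F \<subseteq> \<Lambda> \<inter> ball \<eta> R \<Longrightarrow> card F \<le> K * R powr \<alpha>"
    and F: "finite F" "F \<subseteq> \<Lambda> - ball \<eta> R"
  shows "(\<Sum>\<xi>\<in>F. norm (\<xi> - \<eta>) powr - \<beta>)
    \<le> K * 2 powr \<alpha> / (1 - 2 powr (\<alpha> - \<beta>)) * R powr (\<alpha> - \<beta>)"
proof -
  let ?q = "2 powr (\<alpha> - \<beta>) :: real"
  have q: "0 < ?q" "?q < 1" using \<open>\<alpha> < \<beta>\<close> by (simp_all add: powr_less_one)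
  \<comment> \<open>A crude choice: a power of 2 above the sum of all distances exceeds each of
    them.\<close>
  obtain N where N: "(\<Sum>\<xi>\<in>F. dist \<eta> \<xi>) < 2 ^ N"
    using real_arch_pow[of 2] by auto
  have "F \<subseteq> \<Lambda> \<inter> ball \<eta> (2 ^ N * R) - ball \<eta> R"
  proof
    fix \<xi> assume "\<xi> \<in> F"
    then have "dist \<eta> \<xi> \<le> (\<Sum>\<xi>\<in>F. dist \<eta> \<xi>)"
      using F(1) by (intro member_le_sum) auto
    also note N
    also have "(2::real) ^ N \<le> 2 ^ N * R" using \<open>1 \<le> R\<close> by simp
    finally show "\<xi> \<in> \<Lambda> \<inter> ball \<eta> (2 ^ N * R) - ball \<eta> R"
      using \<open>\<xi> \<in> F\<close> F(2) by auto
  qed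
  then have "(\<Sum>\<xi>\<in>F. norm (\<xi> - \<eta>) powr - \<beta>)
    \<le> K * 2 powr \<alpha> * R powr (\<alpha> - \<beta>) * (\<Sum>k<N. ?q ^ k)"
    using F(1) assms by (intro sum_powr_dyadic_le[of K \<beta> R \<Lambda>]) auto
  also have "(\<Sum>k<N. ?q ^ k) \<le> (\<Sum>k. ?q ^ k)"
    using q by (intro sum_le_suminf summable_geometric) auto
  also have "\<dots> = 1 / (1 - ?q)"
    using q by (intro suminf_geometric) simp
  finally show ?thesis
    using \<open>0 \<le> K\<close> by (simp add: mult_left_mono)
qed

section \<open>Contradiction with the lower frame bound\<close>

theorem proposition2p2:
  fixes \<mu> :: "(real ^ 'd) measure" and \<alpha> \<beta> :: real
  assumes "finite_borel_measure \<mu>"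
    and "0 \<le> \<alpha>" and "\<alpha> < \<beta>" and "\<beta> \<le> real CARD('d)"
    and "\<exists>f\<in>L2 \<mu>. \<not> (AE x in \<mu>. f x = 0) \<and>
           (\<exists>C::real. \<forall>\<xi>. \<xi> \<noteq> 0 \<longrightarrow> cmod (fourier \<mu> f \<xi>) \<le> C * norm \<xi> powr (- \<beta> / 2))"
    and "\<exists>c>0. \<forall>r::real. 0 < r \<and> r \<le> 1 \<longrightarrow>
           (SUP x. measure \<mu> (ball x r)) \<ge> c * r powr \<alpha>"
  shows "\<not> admits_fourier_frame \<mu>"
proof
  assume "admits_fourier_frame \<mu>"
  then obtain \<Lambda> A B where AB: "0 < A" "A \<le> B"
    and summable: "\<And>f. f \<in> L2 \<mu> \<Longrightarrow> (\<lambda>\<xi>. (cmod (fourier \<mu> f \<xi>))\<^sup>2) summable_on \<Lambda>"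
    and lower: "\<And>f. f \<in> L2 \<mu> \<Longrightarrow>
      A * (L2_norm \<mu> f)\<^sup>2 \<le> (\<Sum>\<^sub>\<infinity>\<xi>\<in>\<Lambda>. (cmod (fourier \<mu> f \<xi>))\<^sup>2)"
    and upper: "\<And>f. f \<in> L2 \<mu> \<Longrightarrow>
      (\<Sum>\<^sub>\<infinity>\<xi>\<in>\<Lambda>. (cmod (fourier \<mu> f \<xi>))\<^sup>2) \<le> B * (L2_norm \<mu> f)\<^sup>2"
    unfolding admits_fourier_frame_def frame_spectrum_def by blast
  have \<mu>: "sets \<mu> = sets borel" "finite_measure \<mu>"
    using assms(1) by (auto simp: finite_borel_measure_def)
  obtain f C where f: "f \<in> L2 \<mu>" "\<not> (AE x in \<mu>. f x = 0)"
    and decay: "\<And>\<xi>. \<xi> \<noteq> 0 \<Longrightarrow> cmod (fourier \<mu> f \<xi>) \<le> C * norm \<xi> powr (- \<beta> / 2)"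
    using assms(5) by blast
  obtain c where "0 < c"
    and mass: "\<And>r. 0 < r \<Longrightarrow> r \<le> 1 \<Longrightarrow> c * r powr \<alpha> \<le> (SUP x. measure \<mu> (ball x r))"
    using assms(6) by blast
  \<comment> \<open>The terms are nonnegative and summable, so finite partial sums inherit the upper
    frame bound.\<close>
  have "(\<Sum>\<xi>\<in>F. (cmod (fourier \<mu> g \<xi>))\<^sup>2) \<le> B * (L2_norm \<mu> g)\<^sup>2"
    if "g \<in> L2 \<mu>" "finite F" "F \<subseteq> \<Lambda>" for g F
    using finite_sum_le_infsum[OF summable[OF that(1)] that(2,3)] upper[OF that(1)] by force
  from bessel_card_le_powr[OF \<mu> this _ \<open>0 < c\<close> mass] AB
  have "\<exists>K\<ge>0. \<forall>\<eta> R F. 1 \<le> R \<longrightarrow> finite F \<longrightarrow> F \<subseteq> \<Lambda> \<inter> ball \<eta> R \<longrightarrow> card F \<le> K * R powr \<alpha>"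
    by simp
  then obtain K where "0 \<le> K" and card: "\<And>\<eta> R F. 1 \<le> R \<Longrightarrow> finite F \<Longrightarrow>
      F \<subseteq> \<Lambda> \<inter> ball \<eta> R \<Longrightarrow> card F \<le> K * R powr \<alpha>"
    by blast
  \<comment> \<open>\<open>C\<^sup>2\<close> stems from squaring the decay estimate, the other
    factor from \<open>sum_powr_tail_le\<close>.\<close>
  let ?D = "C\<^sup>2 * (K * 2 powr \<alpha> / (1 - 2 powr (\<alpha> - \<beta>)))"
  have bound: "A * (L2_norm \<mu> f)\<^sup>2 \<le> ?D * R powr (\<alpha> - \<beta>)" if "1 \<le> R" for R
  proof -
    have "\<alpha> < real DIM(real ^ 'd)" using assms(3,4) by simp
    then obtain \<eta> where \<eta>: "\<Lambda> \<inter> ball \<eta> R = {}"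
      using exists_ball_disjoint[of \<alpha> R \<Lambda> K] card[of _ _ 0] \<open>1 \<le> R\<close> by force
    have "A * (L2_norm \<mu> f)\<^sup>2 \<le> (\<Sum>\<^sub>\<infinity>\<xi>\<in>\<Lambda>. (cmod (fourier \<mu> (modulate \<eta> f) \<xi>))\<^sup>2)"
      using lower[OF modulate_in_L2[OF \<mu>(1) f(1)]] by simp
    also have "\<dots> \<le> ?D * R powr (\<alpha> - \<beta>)"
    proof (rule infsum_le_finite_sums)
      show "(\<lambda>\<xi>. (cmod (fourier \<mu> (modulate \<eta> f) \<xi>))\<^sup>2) summable_on \<Lambda>"
        by (intro summable modulate_in_L2 \<mu> f)
    next
      fix F assume F: "finite F" "F \<subseteq> \<Lambda>"
      have "(\<Sum>\<xi>\<in>F. (cmod (fourier \<mu> (modulate \<eta> f) \<xi>))\<^sup>2)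
        \<le> (\<Sum>\<xi>\<in>F. C\<^sup>2 * norm (\<xi> - \<eta>) powr - \<beta>)"
      proof (rule sum_mono)
        fix \<xi> assume "\<xi> \<in> F"
        \<comment> \<open>The empty ball contains its centre \<open>\<eta>\<close>, so
          \<open>\<eta>\<close> is not in \<open>\<Lambda>\<close> and the decay estimate, which
          excludes frequency 0, applies.\<close>
        then have "\<xi> - \<eta> \<noteq> 0" using F \<eta> \<open>1 \<le> R\<close> by auto
        then have "(cmod (fourier \<mu> f (\<xi> - \<eta>)))\<^sup>2 \<le> (C * norm (\<xi> - \<eta>) powr (- \<beta> / 2))\<^sup>2"
          by (intro power_mono decay) auto
        also have "\<dots> = C\<^sup>2 * norm (\<xi> - \<eta>) powr - \<beta>"
          by (simp add: power_mult_distrib power2_eq_square flip: powr_add)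
        finally show "(cmod (fourier \<mu> (modulate \<eta> f) \<xi>))\<^sup>2 \<le> C\<^sup>2 * norm (\<xi> - \<eta>) powr - \<beta>"
          by (simp add: fourier_modulate)
      qed
      also have "\<dots> = C\<^sup>2 * (\<Sum>\<xi>\<in>F. norm (\<xi> - \<eta>) powr - \<beta>)"
        by (simp add: sum_distrib_left)
      also have "(\<Sum>\<xi>\<in>F. norm (\<xi> - \<eta>) powr - \<beta>)
        \<le> K * 2 powr \<alpha> / (1 - 2 powr (\<alpha> - \<beta>)) * R powr (\<alpha> - \<beta>)"
        using F \<eta> assms(2,3) \<open>0 \<le> K\<close> \<open>1 \<le> R\<close> card by (intro sum_powr_tail_le[of K \<beta> \<alpha> R \<Lambda>]) auto
      finally show "(\<Sum>\<xi>\<in>F. (cmod (fourier \<mu> (modulate \<eta> f) \<xi>))\<^sup>2) \<le> ?D * R powr (\<alpha> - \<beta>)"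
        by (simp add: mult_left_mono mult.assoc)
    qed
    finally show ?thesis .
  qed
  \<comment> \<open>The left side of \<open>bound\<close> and \<open>?D\<close> do not depend on
    \<open>R\<close>, although \<open>\<eta>\<close> did; letting \<open>R\<close> tend to infinity
    leaves a nonpositive upper bound.\<close>
  have "((\<lambda>R. ?D * R powr (\<alpha> - \<beta>)) \<longlongrightarrow> ?D * 0) at_top"
    using assms(3) by (intro tendsto_mult_left tendsto_neg_powr filterlim_ident) simp
  then have "A * (L2_norm \<mu> f)\<^sup>2 \<le> ?D * 0"
    by (rule tendsto_lowerbound[OF _ eventually_mono[OF eventually_ge_at_top[of 1] bound]]) simp_all
  then have "L2_norm \<mu> f = 0"
    using \<open>0 < A\<close> by (simp add: mult_le_0_iff)
  then show False
    using f L2_norm_eq_0_iff by blast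
qed

end
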